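(* Let $L\in\mathbb R^{n\times n}$, $Q\in\mathbb R^{n\times p}$ and $M\in\mathbb R^{n\times m}$ be matrices, let $L_s=\frac12(L+L^\top)$, and let $\omega>0$. Define $$\rho=\omega\,\lambda_{\max}\!\left((L_s^{1/2})^\dagger QQ^\top(L_s^{1/2})^\dagger\right),\qquad \tau=\|Q^\top(M^\top)^\dagger\|^2,$$ and $\Omega=\ker(M^\top)$. Suppose that $L_s\succeq0$, $\ker(L_s)=\Omega$, $\Omega\subseteq\ker(Q^\top)$, and $L_s-\frac12MM^\top\succeq0$. Then: (i) If $\tau,\rho>0$, then $\frac{2}{\omega\tau}\le\frac4\rho$, that is, $\left(0,\frac{2}{\omega\tau}\right)\subseteq\left(0,\frac4\rho\right)$. (ii) For any $\gamma\in\left(0,\frac{2}{\omega\tau}\right)$, define $\Xi_\gamma=L_s-\frac{\gamma\omega}4QQ^\top$, $\beta_\gamma=\left\|(\Xi_\gamma^{1/2})^\dagger M\right\|^{-2}$, and $\beta_\gamma^{\rm DTT}=\frac{2-\gamma\omega\tau}{4}$. Then $\beta_\gamma\ge\beta_\gamma^{\rm DTT}$.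
   Context: $T^\dagger$ is the Moore–Penrose inverse, $\|\cdot\|$ the spectral (operator) norm, $\lambda_{\max}$ the largest eigenvalue of a symmetric matrix, $T\succeq0$ means positive semidefinite (for symmetric $T$), and $T^{1/2}$ the positive semidefinite square root. Convention: $a/0=+\infty$ for $a>0$. *)

theory Defs
  imports "HOL-Analysis.Analysis"
begin

definition mat_ker :: "real ^ 'n ^ 'm \<Rightarrow> (real ^ 'n) set" where
  "mat_ker A = {x. A *v x = 0}"

definition spectral_norm :: "real ^ 'n ^ 'm \<Rightarrow> real" where
  "spectral_norm A = onorm ((*v) A)"

definition psd :: "real ^ 'n ^ 'n \<Rightarrow> bool" where
  "psd A \<longleftrightarrow> transpose A = A \<and> (\<forall>x. 0 \<le> x \<bullet> (A *v x))"

text \<open>Meaningful only for positive semidefinite arguments, where such a matrix exists and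
  is unique.\<close>

definition psd_sqrt :: "real ^ 'n ^ 'n \<Rightarrow> real ^ 'n ^ 'n" where
  "psd_sqrt A = (THE S. psd S \<and> S ** S = A)"

definition is_eigenvalue :: "real ^ 'n ^ 'n \<Rightarrow> real \<Rightarrow> bool" where
  "is_eigenvalue A l \<longleftrightarrow> (\<exists>v. v \<noteq> 0 \<and> A *v v = l *\<^sub>R v)"

text \<open>Meaningful only for matrices with a real eigenvalue, in particular symmetric ones.\<close>

definition lambda_max :: "real ^ 'n ^ 'n \<Rightarrow> real" where
  "lambda_max A = (GREATEST l. is_eigenvalue A l)"

text \<open>The four Penrose equations determine the Moore--Penrose inverse uniquely.\<close>

definition is_pinv :: "real ^ 'n ^ 'm \<Rightarrow> real ^ 'm ^ 'n \<Rightarrow> bool" where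
  "is_pinv A X \<longleftrightarrow>
     A ** X ** A = A \<and> X ** A ** X = X \<and>
     transpose (A ** X) = A ** X \<and> transpose (X ** A) = X ** A"

definition pinv :: "real ^ 'n ^ 'm \<Rightarrow> real ^ 'm ^ 'n" where
  "pinv A = (THE X. is_pinv A X)"

end

theory Submission imports Defs begin

text \<open>
  Everything follows from comparing quadratic forms.  The inclusion
  \<open>ker M\<^sup>T \<subseteq> ker Q\<^sup>T\<close> means that \<open>Q\<^sup>T\<close> factors as
  \<open>Q\<^sup>T (M\<^sup>T)\<^sup>\<dagger> M\<^sup>T\<close>, since \<open>(M\<^sup>T)\<^sup>\<dagger> M\<^sup>T\<close> changes a vector
  only by an element of \<open>ker M\<^sup>T\<close>
  (\<open>norm_le_via_pinv\<close>).  Hence \<open>|Q\<^sup>T x|\<^sup>2 \<le> \<tau> |M\<^sup>T x|\<^sup>2\<close>,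
  and with \<open>M M\<^sup>T \<le> 2 L\<^sub>s\<close> this gives \<open>Q Q\<^sup>T \<le> \<tau> M M\<^sup>T \<le> 2 \<tau> L\<^sub>s\<close>.

  A bound \<open>N N\<^sup>T \<le> c A\<close> with \<open>A\<close> positive semidefinite turns into
  \<open>|N\<^sup>T (A\<^bsup>1/2\<^esup>)\<^sup>\<dagger> x|\<^sup>2 \<le> c |x|\<^sup>2\<close>, because
  \<open>A\<^bsup>1/2\<^esup> (A\<^bsup>1/2\<^esup>)\<^sup>\<dagger>\<close> is an orthogonal projection
  (\<open>norm_transpose_pinv_sqrt_le\<close>).
  Taking \<open>A = L\<^sub>s\<close>, \<open>N = Q\<close>, \<open>c = 2\<tau>\<close> bounds every
  eigenvalue occurring in the definition of \<open>\<rho>\<close>, so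
  \<open>\<rho> \<le> 2\<omega>\<tau>\<close>, which is (i).  For (ii), subtracting the two estimates yields
  \<open>\<Xi>\<^sub>\<gamma> \<ge> (1/2 - \<gamma>\<omega>\<tau>/4) M M\<^sup>T\<close>, and the same
  principle with \<open>A = \<Xi>\<^sub>\<gamma>\<close>, \<open>N = M\<close> bounds the norm of
  \<open>(\<Xi>\<^sub>\<gamma>\<^bsup>1/2\<^esup>)\<^sup>\<dagger> M\<close>, which equals that of its transpose.

  The square root, the Moore--Penrose inverse and the largest eigenvalue are defined by
  descriptions, so their existence and uniqueness have to be established; all three come from
  the spectral theorem for symmetric matrices, which is derived from the fact that a
  maximiser of the Rayleigh quotient is an eigenvector.
\<close>

section \<open>Symmetric matrices and orthonormal eigenbases\<close>

text \<open>This rewrite rule turns \<open>N\<^sup>T x\<close> into a row-vector product, after which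
  \<open>N (N\<^sup>T x)\<close> no longer matches the associativity law for matrix products.\<close>

declare transpose_matrix_vector [simp del]

lemma inner_transpose_mult:
  fixes A :: "real ^ 'n ^ 'm"
  shows "(transpose A *v x) \<bullet> y = x \<bullet> (A *v y)"
  by (metis dot_lmul_matrix transpose_matrix_vector)

lemma inner_mult_transpose:
  fixes A :: "real ^ 'n ^ 'm"
  shows "(A *v x) \<bullet> y = x \<bullet> (transpose A *v y)"
  by (metis inner_transpose_mult transpose_transpose)

lemma inner_Gram:
  fixes N :: "real ^ 'm ^ 'n"
  shows "x \<bullet> ((N ** transpose N) *v x) = (norm (transpose N *v x))\<^sup>2"
  unfolding dot_square_norm[symmetric]
  by (simp add: inner_transpose_mult matrix_vector_mul_assoc)

lemma transpose_scaleR: "transpose (c *\<^sub>R A) = c *\<^sub>R transpose (A :: real ^ 'n ^ 'm)"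
  by (simp add: transpose_def vec_eq_iff)

lemma transpose_minus: "transpose (A - B) = transpose A - transpose (B :: real ^ 'n ^ 'm)"
  by (simp add: transpose_def vec_eq_iff)

text \<open>
  If \<open>v\<close> maximises the Rayleigh quotient with value \<open>\<mu>\<close>, then
  \<open>\<mu> |w|\<^sup>2 - w \<bullet> A w\<close> is nonnegative on \<open>V\<close> and vanishes at \<open>v\<close>.
  Moving from \<open>v\<close> in the direction \<open>u = A v - \<mu> v\<close> changes it to first order
  by \<open>-2 |u|\<^sup>2\<close>, so \<open>u\<close> must be zero.  Working in an invariant subspace lets
  the lemma drive the induction in the spectral theorem.
\<close>

lemma Rayleigh_maximiser_is_eigenvector:
  fixes A :: "real ^ 'n ^ 'n"
  assumes sym: "transpose A = A" and V: "subspace V" and inv: "\<And>x. x \<in> V \<Longrightarrow> A *v x \<in> V"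
    and nz: "x0 \<in> V" "x0 \<noteq> 0"
  obtains v where "v \<in> V" "norm v = 1" "A *v v = (v \<bullet> (A *v v)) *\<^sub>R v"
    "\<And>w. w \<in> V \<Longrightarrow> w \<bullet> (A *v w) \<le> (v \<bullet> (A *v v)) * (norm w)\<^sup>2"
proof -
  have cpt: "compact (sphere 0 1 \<inter> V)"
    by (simp add: V closed_subspace compact_Int_closed)
  have ne: "(1 / norm x0) *\<^sub>R x0 \<in> sphere 0 1 \<inter> V"
    using nz V by (simp add: subspace_scale)
  have cont: "continuous_on (sphere 0 1 \<inter> V) (\<lambda>x. x \<bullet> (A *v x))"
    by (intro continuous_intros linear_continuous_on)
       (simp add: linear_linear)
  obtain v where v: "v \<in> V" "norm v = 1"
    and vmax: "\<And>w. w \<in> V \<Longrightarrow> norm w = 1 \<Longrightarrow> w \<bullet> (A *v w) \<le> v \<bullet> (A *v v)"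
    using continuous_attains_sup[OF cpt _ cont] ne by fastforce
  define \<mu> where "\<mu> = v \<bullet> (A *v v)"
  have le: "w \<bullet> (A *v w) \<le> \<mu> * (norm w)\<^sup>2" if w: "w \<in> V" for w
  proof (cases "w = 0")
    case False
    define z where "z = (1 / norm w) *\<^sub>R w"
    have "z \<in> V" "norm z = 1"
      using w False V by (auto simp: z_def subspace_scale)
    then have "z \<bullet> (A *v z) \<le> \<mu>"
      using vmax \<mu>_def by auto
    moreover have wz: "w = norm w *\<^sub>R z"
      using False by (simp add: z_def)
    have "w \<bullet> (A *v w) = (norm w)\<^sup>2 * (z \<bullet> (A *v z))"
      by (subst (1 2) wz) (simp add: matrix_vector_mult_scaleR power2_eq_square)
    ultimately show ?thesis
      by (simp add: mult_right_mono mult.commute)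
  qed (simp)
  define u where "u = A *v v - \<mu> *\<^sub>R v"
  define a where "a = (norm u)\<^sup>2"
  define h where "h = \<mu> * (norm u)\<^sup>2 - u \<bullet> (A *v u)"
  have uV: "u \<in> V"
    using V inv v by (simp add: u_def subspace_diff subspace_scale)
  have symi: "x \<bullet> (A *v y) = y \<bullet> (A *v x)" for x y
    by (metis inner_transpose_mult sym inner_commute)
  have a_eq: "a = u \<bullet> (A *v v) - \<mu> * (u \<bullet> v)"
    unfolding a_def dot_square_norm[symmetric]
    by (subst (2) u_def) (simp add: inner_diff_right)
  have quad: "2 * t * a \<le> t\<^sup>2 * h" for t
  proof -
    have "v + t *\<^sub>R u \<in> V"
      using V v uV by (simp add: subspace_add subspace_scale)
    then have *: "(v + t *\<^sub>R u) \<bullet> (A *v (v + t *\<^sub>R u)) \<le> \<mu> * (norm (v + t *\<^sub>R u))\<^sup>2"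
      by (rule le)
    have 1: "(v + t *\<^sub>R u) \<bullet> (A *v (v + t *\<^sub>R u))
        = \<mu> + 2 * t * (u \<bullet> (A *v v)) + t\<^sup>2 * (u \<bullet> (A *v u))"
      by (simp add: matrix_vector_right_distrib matrix_vector_mult_scaleR inner_add_left
          inner_add_right \<mu>_def symi[of v u] power2_eq_square algebra_simps)
    have 2: "(norm (v + t *\<^sub>R u))\<^sup>2 = 1 + 2 * t * (u \<bullet> v) + t\<^sup>2 * (norm u)\<^sup>2"
    proof -
      have "v \<bullet> v = 1" using v by (simp add: dot_square_norm)
      then show ?thesis
        unfolding dot_square_norm[symmetric]
        by (simp add: inner_add_left inner_add_right inner_commute power2_eq_square algebra_simps)
    qed
    show ?thesis
      using * unfolding 1 2 a_eq h_def by (simp add: algebra_simps)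
  qed
  have h0: "h \<ge> 0" using le[OF uV] by (simp add: h_def)
  have "a = 0"
  proof (cases "h = 0")
    case True
    then show ?thesis using quad[of 1] by (simp add: a_def)
  next
    case False
    have "2 * (a / h) * a \<le> (a / h)\<^sup>2 * h" by (rule quad)
    then have "2 * a\<^sup>2 / h \<le> a\<^sup>2 / h"
      using False by (simp add: power2_eq_square)
    then have "a\<^sup>2 \<le> 0"
      using False h0 by (simp add: divide_le_cancel)
    then show ?thesis by simp
  qed
  then have "A *v v = \<mu> *\<^sub>R v"
    by (simp add: a_def u_def)
  then show thesis
    using that v le \<mu>_def by auto
qed

definition orthonormal_eigenbasis :: "real ^ 'n ^ 'n \<Rightarrow> (real ^ 'n) set \<Rightarrow> bool" where
  "orthonormal_eigenbasis A B \<longleftrightarrow> finite B \<and> pairwise orthogonal B \<and>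
     (\<forall>b\<in>B. norm b = 1 \<and> A *v b = (b \<bullet> (A *v b)) *\<^sub>R b) \<and> span B = UNIV"

text \<open>
  Split off a Rayleigh maximiser: its orthogonal complement inside an invariant subspace is
  again invariant, by symmetry of the matrix, and has smaller dimension.
\<close>

lemma invariant_subspace_eigenbasis:
  fixes A :: "real ^ 'n ^ 'n"
  assumes sym: "transpose A = A"
  shows "subspace V \<Longrightarrow> (\<forall>x\<in>V. A *v x \<in> V) \<Longrightarrow>
    \<exists>B. finite B \<and> pairwise orthogonal B \<and>
     (\<forall>b\<in>B. norm b = 1 \<and> A *v b = (b \<bullet> (A *v b)) *\<^sub>R b) \<and> span B = V"
proof (induction "dim V" arbitrary: V rule: less_induct)
  case less
  show ?case
  proof (cases "V = {0}")
    case True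
    then show ?thesis by (intro exI[of _ "{}"]) auto
  next
    case False
    then obtain x0 where x0: "x0 \<in> V" "x0 \<noteq> 0"
      using less.prems(1) subspace_0 by blast
    obtain v where v: "v \<in> V" "norm v = 1" "A *v v = (v \<bullet> (A *v v)) *\<^sub>R v"
      using Rayleigh_maximiser_is_eigenvector[OF sym less.prems(1) _ x0] less.prems(2) by metis
    have vv: "v \<bullet> v = 1" using v(2) by (simp add: dot_square_norm)
    define W where "W = {x \<in> V. v \<bullet> x = 0}"
    have W: "subspace W"
      using less.prems(1) by (auto simp: W_def subspace_def inner_add_right)
    have "v \<notin> W" using vv by (simp add: W_def)
    moreover have "W \<subseteq> V" by (auto simp: W_def)
    ultimately have "W \<subset> V" using v(1) by blast
    then have dim: "dim W < dim V"
      by (metis W dim_psubset less.prems(1) span_eq_iff)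
    have "v \<bullet> (A *v x) = 0" if "x \<in> W" for x
    proof -
      have "v \<bullet> (A *v x) = (A *v v) \<bullet> x"
        by (metis inner_transpose_mult sym)
      also have "\<dots> = 0"
        using that by (subst v(3)) (simp add: W_def)
      finally show ?thesis .
    qed
    then have invW: "\<forall>x\<in>W. A *v x \<in> W"
      using less.prems(2) by (simp add: W_def)
    obtain B where B: "finite B" "pairwise orthogonal B"
      "\<forall>b\<in>B. norm b = 1 \<and> A *v b = (b \<bullet> (A *v b)) *\<^sub>R b" "span B = W"
      using less.hyps[OF dim W invW] by auto
    have BW: "B \<subseteq> W" using B(4) span_superset by blast
    have "pairwise orthogonal (insert v B)"
      using B(2) BW by (auto simp: pairwise_insert orthogonal_def W_def inner_commute)
    moreover have "span (insert v B) = V"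
    proof
      show "span (insert v B) \<subseteq> V"
        using BW v(1) less.prems(1) by (intro span_minimal) (auto simp: W_def)
      show "V \<subseteq> span (insert v B)"
      proof
        fix x assume x: "x \<in> V"
        have "x - (v \<bullet> x) *\<^sub>R v \<in> W"
          using x v(1) vv less.prems(1)
          by (simp add: W_def subspace_diff subspace_scale inner_diff_right)
        then show "x \<in> span (insert v B)"
          using B(4) span_breakdown_eq by blast
      qed
    qed
    ultimately show ?thesis
      using B v by (intro exI[of _ "insert v B"]) auto
  qed
qed

theorem symmetric_orthonormal_eigenbasis:
  fixes A :: "real ^ 'n ^ 'n"
  assumes "transpose A = A"
  obtains B where "orthonormal_eigenbasis A B"
  using invariant_subspace_eigenbasis[OF assms, of UNIV]
  unfolding orthonormal_eigenbasis_def by auto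

lemma matrix_eq_on_eigenbasis:
  fixes A X Y :: "real ^ 'n ^ 'n"
  assumes "orthonormal_eigenbasis A B" and "\<And>b. b \<in> B \<Longrightarrow> X *v b = Y *v b"
  shows "X = Y"
proof -
  have "X *v x = Y *v x" for x
    using assms linear_eq_on_span[of "(*v) X" "(*v) Y" B x]
    by (simp add: orthonormal_eigenbasis_def)
  then show ?thesis by (simp add: matrix_eq)
qed

text \<open>
  When \<open>B\<close> is an orthonormal eigenbasis of \<open>A\<close> and \<open>g b\<close> is a function of the
  eigenvalue at \<open>b\<close>, this is that function applied to \<open>A\<close> in the sense of the
  functional calculus.
\<close>

definition spectral_combination :: "(real ^ 'n) set \<Rightarrow> (real ^ 'n \<Rightarrow> real) \<Rightarrow> real ^ 'n ^ 'n" where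
  "spectral_combination B g = matrix (\<lambda>x. \<Sum>b\<in>B. (g b * (b \<bullet> x)) *\<^sub>R b)"

lemma spectral_combination_mult:
  "spectral_combination B g *v x = (\<Sum>b\<in>B. (g b * (b \<bullet> x)) *\<^sub>R b)"
  unfolding spectral_combination_def
  by (intro matrix_works, unfold linear_matrix_vector_mul_eq)
     (auto intro!: linearI simp: inner_add_right algebra_simps sum.distrib scaleR_sum_right)

lemma inner_spectral_combination:
  "y \<bullet> (spectral_combination B g *v x) = (\<Sum>b\<in>B. g b * (b \<bullet> x) * (b \<bullet> y))"
  by (simp add: spectral_combination_mult inner_sum_right inner_commute)

lemma transpose_spectral_combination:
  fixes B :: "(real ^ 'n) set"
  shows "transpose (spectral_combination B g) = spectral_combination B g"
proof -
  have "y \<bullet> (transpose (spectral_combination B g) *v x) = y \<bullet> (spectral_combination B g *v x)"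
    for x y :: "real ^ 'n"
    by (subst inner_commute, subst inner_transpose_mult)
       (simp add: inner_spectral_combination mult_ac)
  then show ?thesis
    by (metis matrix_eq vector_eq_ldot)
qed

lemma spectral_combination_basis:
  assumes "orthonormal_eigenbasis A B" "b \<in> B"
  shows "spectral_combination B g *v b = g b *\<^sub>R b"
proof -
  have "(\<Sum>c\<in>B. (g c * (c \<bullet> b)) *\<^sub>R c) = (\<Sum>c\<in>B. if c = b then g b *\<^sub>R b else 0)"
  proof (rule sum.cong)
    fix c assume "c \<in> B"
    then show "(g c * (c \<bullet> b)) *\<^sub>R c = (if c = b then g b *\<^sub>R b else 0)"
      using assms
      by (auto simp: orthonormal_eigenbasis_def pairwise_def orthogonal_def dot_square_norm)
  qed simp
  then show ?thesis
    using assms by (simp add: spectral_combination_mult orthonormal_eigenbasis_def)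
qed

section \<open>Square roots and Moore--Penrose inverses\<close>

text \<open>
  Uniqueness: on an eigenvector \<open>b\<close> of \<open>A\<close> with eigenvalue \<open>\<mu>\<close>, the vector
  \<open>y = S b - \<surd>\<mu> b\<close> satisfies \<open>S y = -\<surd>\<mu> y\<close>, which for a positive
  semidefinite \<open>S\<close> forces \<open>y = 0\<close>.
\<close>

lemma psd_sqrt_eigenvector:
  fixes S :: "real ^ 'n ^ 'n"
  assumes "psd S" and eig: "(S ** S) *v b = \<mu> *\<^sub>R b" and "\<mu> \<ge> 0"
  shows "S *v b = sqrt \<mu> *\<^sub>R b"
proof -
  have sym: "transpose S = S" and pos: "\<And>x. 0 \<le> x \<bullet> (S *v x)"
    using assms(1) by (auto simp: psd_def)
  have SS: "S *v (S *v b) = \<mu> *\<^sub>R b"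
    using eig by (simp add: matrix_vector_mul_assoc)
  show ?thesis
  proof (cases "\<mu> = 0")
    case True
    have "(norm (S *v b))\<^sup>2 = b \<bullet> (S *v (S *v b))"
      unfolding dot_square_norm[symmetric] by (metis inner_transpose_mult sym)
    then show ?thesis using SS True by simp
  next
    case False
    define y where "y = S *v b - sqrt \<mu> *\<^sub>R b"
    have "S *v y = - (sqrt \<mu> *\<^sub>R y)"
      using assms(3) SS
      by (simp add: y_def matrix_vector_mult_diff_distrib matrix_vector_mult_scaleR
          scaleR_diff_right)
    then have "0 \<le> - (sqrt \<mu> * (norm y)\<^sup>2)"
      using pos[of y] by (simp add: dot_square_norm)
    then have "y = 0"
      using False assms(3) by (simp add: mult_le_0_iff)
    then show ?thesis by (simp add: y_def)
  qed
qed

lemma psd_sqrt: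
  fixes A :: "real ^ 'n ^ 'n"
  assumes A: "psd A"
  shows "psd (psd_sqrt A)" and "psd_sqrt A ** psd_sqrt A = A"
proof -
  obtain B where B: "orthonormal_eigenbasis A B"
    using symmetric_orthonormal_eigenbasis A psd_def by metis
  define l where "l b = b \<bullet> (A *v b)" for b
  have l: "l b \<ge> 0" for b using A by (simp add: l_def psd_def)
  have Ab: "A *v b = l b *\<^sub>R b" if "b \<in> B" for b
    using B that by (auto simp: orthonormal_eigenbasis_def l_def)
  let ?S = "spectral_combination B (\<lambda>b. sqrt (l b))"
  have "x \<bullet> (?S *v x) \<ge> 0" for x
    using l by (simp add: inner_spectral_combination sum_nonneg mult.assoc)
  then have S: "psd ?S"
    by (simp add: psd_def transpose_spectral_combination)
  have SS: "?S ** ?S = A"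
    by (rule matrix_eq_on_eigenbasis[OF B])
       (simp add: matrix_vector_mul_assoc[symmetric] spectral_combination_basis[OF B]
         matrix_vector_mult_scaleR Ab l)
  have uniq: "T = ?S" if T: "psd T" "T ** T = A" for T
    by (rule matrix_eq_on_eigenbasis[OF B])
       (simp add: spectral_combination_basis[OF B] psd_sqrt_eigenvector[OF T(1)] T(2) Ab l)
  have "psd (psd_sqrt A) \<and> psd_sqrt A ** psd_sqrt A = A"
    unfolding psd_sqrt_def by (rule theI[of _ ?S]) (use S SS uniq in blast)+
  then show "psd (psd_sqrt A)" and "psd_sqrt A ** psd_sqrt A = A" by auto
qed

text \<open>
  The products \<open>A X\<close> and \<open>X A\<close> are determined by \<open>A\<close>, being the orthogonal
  projections onto its range and its row space, and \<open>X = X A X\<close>.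
\<close>

lemma is_pinv_unique:
  fixes A :: "real ^ 'n ^ 'm"
  assumes X: "is_pinv A X" and Y: "is_pinv A Y"
  shows "X = Y"
proof -
  have X1: "A ** X ** A = A" and X2: "X ** A ** X = X"
    and X3: "transpose (A ** X) = A ** X" and X4: "transpose (X ** A) = X ** A"
    using X by (auto simp: is_pinv_def)
  have Y1: "A ** Y ** A = A" and Y2: "Y ** A ** Y = Y"
    and Y3: "transpose (A ** Y) = A ** Y" and Y4: "transpose (Y ** A) = Y ** A"
    using Y by (auto simp: is_pinv_def)
  have "A ** X = (A ** Y) ** (A ** X)"
    using Y1 by (simp add: matrix_mul_assoc)
  also have "\<dots> = transpose ((A ** X) ** (A ** Y))"
    by (simp only: matrix_transpose_mul[of "A ** X" "A ** Y"] X3 Y3)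
  also have "\<dots> = A ** Y"
    using X1 Y3 by (simp add: matrix_mul_assoc)
  finally have AX: "A ** X = A ** Y" .
  have "X ** A = (X ** A) ** (Y ** A)"
    using Y1 by (metis matrix_mul_assoc)
  also have "\<dots> = transpose ((Y ** A) ** (X ** A))"
    by (simp only: matrix_transpose_mul[of "Y ** A" "X ** A"] X4 Y4)
  also have "\<dots> = Y ** A"
    using X1 Y4 by (metis matrix_mul_assoc)
  finally have XA: "X ** A = Y ** A" .
  show ?thesis
    by (metis AX XA X2 Y2 matrix_mul_assoc)
qed

text \<open>
  Invert the nonzero eigenvalues; \<open>inverse 0 = 0\<close> is exactly the value needed on the kernel.
\<close>

lemma symmetric_is_pinv_exists:
  fixes A :: "real ^ 'n ^ 'n"
  assumes "transpose A = A"
  shows "\<exists>X. is_pinv A X \<and> transpose X = X"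
proof -
  obtain B where B: "orthonormal_eigenbasis A B"
    using symmetric_orthonormal_eigenbasis assms by metis
  define l where "l b = b \<bullet> (A *v b)" for b
  have Ab: "A *v b = l b *\<^sub>R b" if "b \<in> B" for b
    using B that by (auto simp: orthonormal_eigenbasis_def l_def)
  let ?X = "spectral_combination B (\<lambda>b. inverse (l b))"
  let ?E = "spectral_combination B (\<lambda>b. l b * inverse (l b))"
  note simps = matrix_vector_mul_assoc[symmetric] spectral_combination_basis[OF B]
    matrix_vector_mult_scaleR Ab
  have AX: "A ** ?X = ?E"
    by (rule matrix_eq_on_eigenbasis[OF B]) (auto simp: simps)
  have XA: "?X ** A = ?E"
    by (rule matrix_eq_on_eigenbasis[OF B]) (auto simp: simps)
  have 1: "?E ** A = A"
    by (rule matrix_eq_on_eigenbasis[OF B]) (auto simp: simps)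
  have 2: "?E ** ?X = ?X"
    by (rule matrix_eq_on_eigenbasis[OF B]) (auto simp: simps)
  have "is_pinv A ?X"
    by (simp add: is_pinv_def AX XA 1 2 transpose_spectral_combination)
  then show ?thesis using transpose_spectral_combination by blast
qed

text \<open>
  The general case reduces to the symmetric one through
  \<open>A\<^sup>\<dagger> = (A\<^sup>T A)\<^sup>\<dagger> A\<^sup>T\<close>, using that \<open>A\<^sup>T A Y = 0\<close>
  implies \<open>A Y = 0\<close>.
\<close>

lemma is_pinv_pinv:
  fixes A :: "real ^ 'n ^ 'm"
  shows "is_pinv A (pinv A)"
proof -
  let ?G = "transpose A ** A"
  have "transpose ?G = ?G" by (simp add: matrix_transpose_mul)
  then obtain P where P: "is_pinv ?G P" "transpose P = P"
    using symmetric_is_pinv_exists by blast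
  have P1: "?G ** P ** ?G = ?G" and P2: "P ** ?G ** P = P"
    and P4: "transpose (P ** ?G) = P ** ?G"
    using P(1) by (auto simp: is_pinv_def)
  let ?X = "P ** transpose A"
  have "(A ** ?X ** A) *v x = A *v x" for x
  proof -
    define y where "y = (P ** ?G) *v x - x"
    have "?G *v y = 0"
      using P1 by (simp add: y_def matrix_vector_mult_diff_distrib matrix_vector_mul_assoc
          matrix_mul_assoc)
    then have "y \<bullet> (transpose A *v (A *v y)) = 0"
      by (simp add: matrix_vector_mul_assoc)
    then have "(A *v y) \<bullet> (A *v y) = 0"
      by (metis inner_mult_transpose)
    then have "A *v y = 0" by simp
    then show ?thesis
      by (simp add: y_def matrix_vector_mult_diff_distrib matrix_vector_mul_assoc matrix_mul_assoc)
  qed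
  then have 1: "A ** ?X ** A = A" by (simp add: matrix_eq)
  have 2: "?X ** A ** ?X = ?X" using P2 by (metis matrix_mul_assoc)
  have 3: "transpose (A ** ?X) = A ** ?X"
    using P(2) by (simp add: matrix_transpose_mul matrix_mul_assoc)
  have 4: "transpose (?X ** A) = ?X ** A" using P4 by (simp add: matrix_mul_assoc)
  have X: "is_pinv A ?X"
    unfolding is_pinv_def using 1 2 3 4 by blast
  show ?thesis
    unfolding pinv_def by (rule theI[of _ ?X]) (use X is_pinv_unique in blast)+
qed

lemma transpose_pinv_symmetric:
  fixes A :: "real ^ 'n ^ 'n"
  assumes "transpose A = A"
  shows "transpose (pinv A) = pinv A"
  using symmetric_is_pinv_exists[OF assms] is_pinv_unique is_pinv_pinv by metis

section \<open>Norm estimates\<close>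

lemma norm_mult_pinv_le:
  fixes A :: "real ^ 'n ^ 'm"
  shows "norm (A *v (pinv A *v x)) \<le> norm x"
proof -
  let ?E = "A ** pinv A"
  have E: "?E ** ?E = ?E" "transpose ?E = ?E"
    using is_pinv_pinv[of A] by (auto simp: is_pinv_def matrix_mul_assoc)
  have "(norm (?E *v x))\<^sup>2 = x \<bullet> (?E *v x)"
    unfolding dot_square_norm[symmetric]
    using E inner_transpose_mult matrix_vector_mul_assoc by metis
  also have "\<dots> \<le> norm x * norm (?E *v x)"
    by (rule norm_cauchy_schwarz)
  finally show ?thesis
    by (cases "norm (?E *v x) = 0") (auto simp: matrix_vector_mul_assoc power2_eq_square)
qed

lemma norm_le_spectral_norm: "norm (A *v x) \<le> spectral_norm A * norm x"
  unfolding spectral_norm_def by (rule onorm) simp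

lemma norm_le_via_pinv:
  fixes C :: "real ^ 'n ^ 'm" and R :: "real ^ 'n ^ 'p"
  assumes "mat_ker C \<subseteq> mat_ker R"
  shows "norm (R *v x) \<le> spectral_norm (R ** pinv C) * norm (C *v x)"
proof -
  have "x - pinv C *v (C *v x) \<in> mat_ker C"
    using is_pinv_pinv[of C]
    by (simp add: mat_ker_def is_pinv_def matrix_vector_mult_diff_distrib
        matrix_vector_mul_assoc matrix_mul_assoc)
  then have "R *v (x - pinv C *v (C *v x)) = 0"
    using assms by (auto simp: mat_ker_def)
  then have "R *v x = (R ** pinv C) *v (C *v x)"
    by (simp add: matrix_vector_mult_diff_distrib matrix_vector_mul_assoc matrix_mul_assoc)
  then show ?thesis using norm_le_spectral_norm by metis
qed

text \<open>
  Substituting \<open>x = (A\<^bsup>1/2\<^esup>)\<^sup>\<dagger> y\<close> in the hypothesis leaves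
  \<open>c\<close> times the squared length of an orthogonal projection of \<open>y\<close>.
\<close>

lemma norm_transpose_pinv_sqrt_le:
  fixes A :: "real ^ 'n ^ 'n" and N :: "real ^ 'm ^ 'n"
  assumes A: "psd A" and c: "c \<ge> 0"
    and le: "\<And>x. (norm (transpose N *v x))\<^sup>2 \<le> c * (x \<bullet> (A *v x))"
  shows "(norm (transpose N *v (pinv (psd_sqrt A) *v y)))\<^sup>2 \<le> c * (norm y)\<^sup>2"
proof -
  let ?S = "psd_sqrt A"
  define x where "x = pinv ?S *v y"
  have "x \<bullet> (A *v x) = (norm (?S *v x))\<^sup>2"
    unfolding dot_square_norm[symmetric]
    using psd_sqrt[OF A] inner_transpose_mult matrix_vector_mul_assoc psd_def by metis
  also have "\<dots> \<le> (norm y)\<^sup>2"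
    unfolding x_def by (intro power_mono norm_mult_pinv_le) simp
  finally show ?thesis
    using le[of x] c by (simp add: x_def mult_left_mono order_trans)
qed

text \<open>
  This is the previous estimate for the transposed matrix.  It transfers by duality:
  for \<open>z = (A\<^bsup>1/2\<^esup>)\<^sup>\<dagger> N y\<close>, Cauchy--Schwarz gives
  \<open>|z|\<^sup>2 \<le> |y| |N\<^sup>T (A\<^bsup>1/2\<^esup>)\<^sup>\<dagger> z| \<le> \<surd>c |y| |z|\<close>.
\<close>

lemma spectral_norm_pinv_sqrt_le:
  fixes A :: "real ^ 'n ^ 'n" and N :: "real ^ 'm ^ 'n"
  assumes A: "psd A" and c: "c \<ge> 0"
    and le: "\<And>x. (norm (transpose N *v x))\<^sup>2 \<le> c * (x \<bullet> (A *v x))"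
  shows "(spectral_norm (pinv (psd_sqrt A) ** N))\<^sup>2 \<le> c"
proof -
  let ?P = "pinv (psd_sqrt A)"
  have P: "transpose ?P = ?P"
    using psd_sqrt(1)[OF A] by (simp add: psd_def transpose_pinv_symmetric)
  have bound: "norm ((?P ** N) *v y) \<le> sqrt c * norm y" for y
  proof -
    define z where "z = (?P ** N) *v y"
    have "norm (transpose N *v (?P *v z)) \<le> sqrt (c * (norm z)\<^sup>2)"
      using norm_transpose_pinv_sqrt_le[OF A c le] by (rule real_le_rsqrt)
    then have adj: "norm (transpose N *v (?P *v z)) \<le> sqrt c * norm z"
      by (simp add: real_sqrt_mult)
    have "norm z * norm z = ((?P ** N) *v y) \<bullet> z"
      by (simp add: z_def[symmetric] dot_square_norm power2_eq_square)
    also have "\<dots> = y \<bullet> (transpose N *v (?P *v z))"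
      by (simp add: inner_mult_transpose matrix_transpose_mul P matrix_vector_mul_assoc)
    also have "\<dots> \<le> norm y * norm (transpose N *v (?P *v z))"
      by (rule norm_cauchy_schwarz)
    also have "\<dots> \<le> norm y * (sqrt c * norm z)"
      using adj by (intro mult_left_mono) auto
    finally have "norm z * norm z \<le> (sqrt c * norm y) * norm z"
      by (simp add: mult_ac)
    then show ?thesis
      using c by (cases "z = 0") (auto simp: z_def)
  qed
  have "spectral_norm (?P ** N) \<le> sqrt c"
    unfolding spectral_norm_def by (rule onorm_le) (rule bound)
  moreover have "spectral_norm (?P ** N) \<ge> 0"
    unfolding spectral_norm_def by (rule onorm_pos_le) simp
  ultimately have "(spectral_norm (?P ** N))\<^sup>2 \<le> (sqrt c)\<^sup>2"
    by (rule power_mono)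
  then show ?thesis using c by simp
qed

text \<open>
  The maximiser of the Rayleigh quotient belongs to an eigenvalue that dominates all others,
  so the greatest eigenvalue exists and inherits any bound on the quadratic form.
\<close>

lemma lambda_max_le:
  fixes A :: "real ^ 'n ^ 'n"
  assumes sym: "transpose A = A" and le: "\<And>x. x \<bullet> (A *v x) \<le> c * (norm x)\<^sup>2"
  shows "lambda_max A \<le> c"
proof -
  obtain x0 :: "real ^ 'n" where "x0 \<noteq> 0"
    using norm_axis_1 by (metis norm_zero zero_neq_one)
  then obtain v where v: "norm v = 1" "A *v v = (v \<bullet> (A *v v)) *\<^sub>R v"
    "\<And>w. w \<bullet> (A *v w) \<le> (v \<bullet> (A *v v)) * (norm w)\<^sup>2"
    using Rayleigh_maximiser_is_eigenvector[OF sym subspace_UNIV, of x0] by auto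
  have "lambda_max A = v \<bullet> (A *v v)"
    unfolding lambda_max_def
  proof (rule Greatest_equality)
    show "is_eigenvalue A (v \<bullet> (A *v v))"
      using v(1,2) by (auto simp: is_eigenvalue_def intro!: exI[of _ v])
    fix l assume "is_eigenvalue A l"
    then obtain w where w: "w \<noteq> 0" "A *v w = l *\<^sub>R w"
      by (auto simp: is_eigenvalue_def)
    then show "l \<le> v \<bullet> (A *v v)"
      using v(3)[of w] by (simp add: dot_square_norm)
  qed
  also have "\<dots> \<le> c" using le[of v] v(1) by simp
  finally show ?thesis .
qed

section \<open>Comparison of the parameter ranges and constants\<close>


theorem propositionA5:
  fixes L :: "real ^ 'n ^ 'n" and Q :: "real ^ 'p ^ 'n" and M :: "real ^ 'm ^ 'n"
    and \<omega> :: real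
  defines "Ls \<equiv> (1/2) *\<^sub>R (L + transpose L)"
  defines "\<rho> \<equiv> \<omega> * lambda_max (pinv (psd_sqrt Ls) ** Q ** transpose Q ** pinv (psd_sqrt Ls))"
  defines "\<tau> \<equiv> (spectral_norm (transpose Q ** pinv (transpose M)))\<^sup>2"
  defines "\<Omega> \<equiv> mat_ker (transpose M)"
  assumes "\<omega> > 0"
    and "psd Ls"
    and "mat_ker Ls = \<Omega>"
    and "\<Omega> \<subseteq> mat_ker (transpose Q)"
    and "psd (Ls - (1/2) *\<^sub>R (M ** transpose M))"
  shows "(\<tau> > 0 \<and> \<rho> > 0 \<longrightarrow>
            2 / (\<omega> * \<tau>) \<le> 4 / \<rho> \<and> {0<..<2 / (\<omega> * \<tau>)} \<subseteq> {0<..<4 / \<rho>})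
       \<and> (\<forall>\<gamma>::real. ereal \<gamma> \<in> {0<..<2 / ereal (\<omega> * \<tau>)} \<longrightarrow>
            (let \<Xi> = Ls - (\<gamma> * \<omega> / 4) *\<^sub>R (Q ** transpose Q);
                 \<beta> = 1 / ereal ((spectral_norm (pinv (psd_sqrt \<Xi>) ** M))\<^sup>2);
                 \<beta>DTT = (2 - \<gamma> * \<omega> * \<tau>) / 4
             in \<beta> \<ge> ereal \<beta>DTT))"
proof -
  have \<omega>: "\<omega> > 0" and Ls: "psd Ls"
    and ker: "mat_ker (transpose M) \<subseteq> mat_ker (transpose Q)"
    and diff: "psd (Ls - (1/2) *\<^sub>R (M ** transpose M))"
    using assms(5-9) by (auto simp: \<Omega>_def)
  have \<tau>0: "\<tau> \<ge> 0" by (simp add: \<tau>_def)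
  have Q_le_M: "(norm (transpose Q *v x))\<^sup>2 \<le> \<tau> * (norm (transpose M *v x))\<^sup>2" for x
    using power_mono[OF norm_le_via_pinv[OF ker, of x], of 2]
    by (simp add: \<tau>_def power_mult_distrib)
  have half_M_le: "(norm (transpose M *v x))\<^sup>2 / 2 \<le> x \<bullet> (Ls *v x)" for x
  proof -
    have "0 \<le> x \<bullet> ((Ls - (1/2) *\<^sub>R (M ** transpose M)) *v x)"
      using diff by (simp add: psd_def)
    then show ?thesis
      by (simp add: matrix_vector_mult_diff_rdistrib scaleR_matrix_vector_assoc[symmetric]
          inner_diff_right inner_Gram)
  qed
  have Q_le_Ls: "(norm (transpose Q *v x))\<^sup>2 \<le> 2 * \<tau> * (x \<bullet> (Ls *v x))" for x
  proof -
    have "\<tau> * (norm (transpose M *v x))\<^sup>2 \<le> \<tau> * (2 * (x \<bullet> (Ls *v x)))"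
      using half_M_le[of x] \<tau>0 by (intro mult_left_mono) auto
    then show ?thesis using Q_le_M[of x] by simp
  qed

  let ?P = "pinv (psd_sqrt Ls)"
  have P: "transpose ?P = ?P"
    using psd_sqrt(1)[OF Ls] by (simp add: psd_def transpose_pinv_symmetric)
  have "lambda_max (?P ** Q ** transpose Q ** ?P) \<le> 2 * \<tau>"
  proof (rule lambda_max_le)
    have eq: "?P ** Q ** transpose Q ** ?P = (?P ** Q) ** transpose (?P ** Q)"
      by (simp add: matrix_transpose_mul P matrix_mul_assoc)
    show "transpose (?P ** Q ** transpose Q ** ?P) = ?P ** Q ** transpose Q ** ?P"
      by (simp add: matrix_transpose_mul P matrix_mul_assoc)
    show "x \<bullet> ((?P ** Q ** transpose Q ** ?P) *v x) \<le> 2 * \<tau> * (norm x)\<^sup>2" for x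
      using norm_transpose_pinv_sqrt_le[OF Ls _ Q_le_Ls, of x] \<tau>0
      unfolding eq inner_Gram
      by (simp add: matrix_transpose_mul P matrix_vector_mul_assoc)
  qed
  then have \<rho>: "\<rho> \<le> 2 * (\<omega> * \<tau>)"
    using \<omega> mult_left_mono[of _ "2 * \<tau>" \<omega>] by (simp add: \<rho>_def mult_ac)
  have i: "2 / (\<omega> * \<tau>) \<le> 4 / \<rho>" if "\<tau> > 0" "\<rho> > 0"
    using that \<omega> \<rho> by (simp add: field_simps)

  have ii: "ereal ((2 - \<gamma> * \<omega> * \<tau>) / 4)
      \<le> 1 / ereal ((spectral_norm (pinv (psd_sqrt (Ls - (\<gamma> * \<omega> / 4) *\<^sub>R (Q ** transpose Q))) ** M))\<^sup>2)"
    if \<gamma>: "ereal \<gamma> \<in> {0<..<2 / ereal (\<omega> * \<tau>)}" for \<gamma>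
  proof -
    define \<Xi> where "\<Xi> = Ls - (\<gamma> * \<omega> / 4) *\<^sub>R (Q ** transpose Q)"
    define d where "d = (2 - \<gamma> * \<omega> * \<tau>) / 4"
    define s where "s = (spectral_norm (pinv (psd_sqrt \<Xi>) ** M))\<^sup>2"
    have \<gamma>0: "\<gamma> > 0" using \<gamma> by simp
    have d: "d > 0"
    \<comment> \<open>If \<open>\<tau> = 0\<close>, the admissible interval is \<open>(0, \<infinity>)\<close> and \<open>d = 1/2\<close>.\<close>
    proof (cases "\<tau> = 0")
      case False
      then have pos: "\<omega> * \<tau> > 0" using \<omega> \<tau>0 by simp
      have "ereal \<gamma> < ereal 2 / ereal (\<omega> * \<tau>)" using \<gamma> by simp
      then have "\<gamma> < 2 / (\<omega> * \<tau>)" using False \<omega> by simp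
      then show ?thesis using pos by (simp add: d_def field_simps)
    qed (simp add: d_def)
    have form: "d * (norm (transpose M *v x))\<^sup>2 \<le> x \<bullet> (\<Xi> *v x)" for x
    proof -
      have "x \<bullet> (\<Xi> *v x) = x \<bullet> (Ls *v x) - (\<gamma> * \<omega> / 4) * (norm (transpose Q *v x))\<^sup>2"
        by (simp add: \<Xi>_def matrix_vector_mult_diff_rdistrib
            scaleR_matrix_vector_assoc[symmetric] inner_diff_right inner_Gram)
      moreover have "(\<gamma> * \<omega> / 4) * (norm (transpose Q *v x))\<^sup>2
          \<le> (\<gamma> * \<omega> / 4) * (\<tau> * (norm (transpose M *v x))\<^sup>2)"
        using Q_le_M \<gamma>0 \<omega> by (intro mult_left_mono) auto
      ultimately show ?thesis
        using half_M_le[of x] by (simp add: d_def field_simps)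
    qed
    have "transpose \<Xi> = \<Xi>"
      using Ls by (simp add: \<Xi>_def psd_def transpose_minus transpose_scaleR matrix_transpose_mul)
    moreover have "0 \<le> x \<bullet> (\<Xi> *v x)" for x
      using form[of x] d by (smt (verit) mult_nonneg_nonneg zero_le_power2)
    ultimately have \<Xi>: "psd \<Xi>" by (simp add: psd_def)
    have s: "s \<le> 1 / d"
      unfolding s_def
    proof (rule spectral_norm_pinv_sqrt_le[OF \<Xi>])
      show "(norm (transpose M *v x))\<^sup>2 \<le> 1 / d * (x \<bullet> (\<Xi> *v x))" for x
        using form[of x] d by (simp add: field_simps)
    qed (use d in simp)
    \<comment> \<open>If \<open>s = 0\<close>, the right-hand side is \<open>\<infinity>\<close>.\<close>
    have "ereal d \<le> 1 / ereal s"
    proof (cases "s = 0")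
      case False
      then have "s > 0" by (simp add: s_def)
      then have "d \<le> 1 / s" using s d by (simp add: field_simps)
      then show ?thesis using False by (simp add: one_ereal_def)
    qed (simp add: zero_ereal_def[symmetric] divide_ereal_def)
    then show ?thesis by (simp add: d_def s_def \<Xi>_def)
  qed
  show ?thesis
    using i ii by (force simp: Let_def)
qed

end
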